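(* Consider the current-driven memristive device $$U(t)=M(x(t))I(t),\qquad \dot{x}(t)=f(x(t),I(t)),$$ with input currents $I$ in an equibounded set $\mathcal{U}^+$ (there exists $\overline I>0$ such that $|I(t)|\le\overline I$ for all $I\in\mathcal{U}^+$, $t\ge0$). If the internal dynamics $\dot{x}=f(x,I)$ is globally $\delta$ISS, then it has FM from $I$ to $x$ (input-to-state FM) on compact sets of initial conditions. Moreover, if in addition the input currents $I$ are continuous and the memristance $M$ is Lipschitz continuous, then the memristive device also has FM from $I$ to $U$ on compact sets of initial conditions.
   Context: Setting: $x(t)\in\mathbb{R}^{n_x}$ is the internal state, $I\in\mathcal{U}^+\subset L_\infty([0,+\infty),\mathbb{R})$ is the (scalar) input current, $U(t)\in\mathbb{R}$ is the output voltage, and $M:\mathbb{R}^{n_x}\to(0,+\infty)$ is the memristance function. The internal dynamics is assumed forward complete (for every considered initial condition and input the state trajectory is uniquely defined on $[0,+\infty)$). Comparison functions: $\alpha:[0,+\infty)\to[0,+\infty)$ is of class $\mathcal{K}$ if it is continuous, strictly increasing and $\alpha(0)=0$; of class $\mathcal{K}_\infty$ if moreover $\lim_{r\to\infty}\alpha(r)=+\infty$. $\beta:[0,+\infty)^2\to[0,+\infty)$ is of class $\mathcal{KL}$ if it is continuous, $\beta(\cdot,s)\in\mathcal{K}$ for each $s$, and for each $r$, $\beta(r,\cdot)$ is nonincreasing with limit $0$ at $+\infty$. Globally $\delta$ISS: there exist $\beta\in\mathcal{KL}$ and $\gamma\in\mathcal{K}_\infty$ such that for any $x_a(0),x_b(0)\in\mathbb{R}^{n_x}$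 and $I_a,I_b\in\mathcal{U}^+$, the state trajectories satisfy for all $t\ge0$: $\|x_a(t)-x_b(t)\|\le\beta(\|x_a(0)-x_b(0)\|,t)+\gamma(\operatorname{ess\,sup}_{s\in[0,t]}|I_a(s)-I_b(s)|)$. Memory kernel: a continuous nonincreasing function $w:[0,+\infty)\to[0,1]$ with $\lim_{\Delta t\to+\infty}w(\Delta t)=0$. FM from $I$ to an output $y$ (here $y=x$ or $y=U$) on a set $\mathcal{X}_0$ of initial conditions: there exist $\beta\in\mathcal{KL}$, $\gamma\in\mathcal{K}_\infty$ and a memory kernel $w$ such that for any $x_a(0),x_b(0)\in\mathcal{X}_0$ and any $I_a,I_b\in\mathcal{U}^+$, the corresponding outputs satisfy for all $t\ge0$ $$\|y_a(t)-y_b(t)\|\le\beta(\|x_a(0)-x_b(0)\|,t)+\gamma\big(\operatorname{ess\,sup}_{s\in[0,t]}w(t-s)|I_a(s)-I_b(s)|\big).$$ "On compact sets of initial conditions" means: for every compact $\mathcal{X}_0\subset\mathbb{R}^{n_x}$ (with $\beta,\gamma,w$ allowed to depend on $\mathcal{X}_0$).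
   Formalization: The set of input currents is additionally assumed closed under forward time shifts (the claim fails for arbitrary equibounded sets), and at t=0 the ess sup over the single point 0 is read as the value at 0. *)

theory Defs
  imports "HOL-Analysis.Analysis" "HOL-Probability.Essential_Supremum"
begin

definition class_K :: "(real \<Rightarrow> real) \<Rightarrow> bool" where
  "class_K \<alpha> \<longleftrightarrow> continuous_on {0..} \<alpha> \<and> strict_mono_on {0..} \<alpha> \<and> \<alpha> 0 = 0"

definition class_K_inf :: "(real \<Rightarrow> real) \<Rightarrow> bool" where
  "class_K_inf \<alpha> \<longleftrightarrow> class_K \<alpha> \<and> filterlim \<alpha> at_top at_top"

definition class_KL :: "(real \<Rightarrow> real \<Rightarrow> real) \<Rightarrow> bool" where
  "class_KL \<beta> \<longleftrightarrow>
     continuous_on ({0..} \<times> {0..}) (\<lambda>(r, s). \<beta> r s) \<and>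
     (\<forall>s\<ge>0. class_K (\<lambda>r. \<beta> r s)) \<and>
     (\<forall>r\<ge>0. antimono_on {0..} (\<beta> r) \<and> (\<beta> r \<longlongrightarrow> 0) at_top)"

definition memory_kernel :: "(real \<Rightarrow> real) \<Rightarrow> bool" where
  "memory_kernel w \<longleftrightarrow>
     continuous_on {0..} w \<and> w ` {0..} \<subseteq> {0..1} \<and> antimono_on {0..} w \<and> (w \<longlongrightarrow> 0) at_top"

text \<open>
  Signals are real functions of which only the values at nonnegative times matter; the elements
  of L-infinity are given by representatives.
\<close>

definition L_infinity :: "(real \<Rightarrow> real) set" where
  "L_infinity =
     {u \<in> borel_measurable (lebesgue_on {0..}). \<exists>C. AE s in lebesgue_on {0..}. \<bar>u s\<bar> \<le> C}"

definition equibounded :: "(real \<Rightarrow> real) set \<Rightarrow> bool" where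
  "equibounded \<U> \<longleftrightarrow> (\<exists>Ibar>0. \<forall>I\<in>\<U>. \<forall>t\<ge>0. \<bar>I t\<bar> \<le> Ibar)"

text \<open>
  Admissible inputs of a time-invariant system: discarding an initial segment of an admissible
  input and resetting the clock gives an admissible input.
\<close>

definition shift_closed :: "(real \<Rightarrow> real) set \<Rightarrow> bool" where
  "shift_closed \<U> \<longleftrightarrow> (\<forall>I\<in>\<U>. \<forall>\<tau>\<ge>0. \<exists>J\<in>\<U>. \<forall>s\<ge>0. J s = I (s + \<tau>))"

text \<open>
  Essential supremum over the interval from 0 to t. The degenerate interval at t = 0 is a null
  set, on which the measure-theoretic value would be minus infinity; there the point value is
  taken. For continuous g this is the ordinary supremum over the interval for every nonnegative t.
\<close>

definition ess_sup_upto :: "real \<Rightarrow> (real \<Rightarrow> real) \<Rightarrow> real" where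
  "ess_sup_upto t g =
     (if t = 0 then g 0 else real_of_ereal (esssup (lebesgue_on {0..t}) (\<lambda>s. ereal (g s))))"

text \<open>
  Since inputs are merely measurable, solutions are understood in the sense of Caratheodory,
  i.e. they satisfy the integral form of the differential equation.
\<close>

definition trajectory ::
  "(real^'n \<Rightarrow> real \<Rightarrow> real^'n) \<Rightarrow> (real \<Rightarrow> real) \<Rightarrow> real^'n \<Rightarrow> (real \<Rightarrow> real^'n) \<Rightarrow> bool" where
  "trajectory f I x0 x \<longleftrightarrow>
     (\<forall>t\<ge>0. set_integrable lebesgue {0..t} (\<lambda>s. f (x s) (I s)) \<and>
            x t = x0 + (LINT s:{0..t}|lebesgue. f (x s) (I s)))"

definition forward_complete ::
  "(real^'n \<Rightarrow> real \<Rightarrow> real^'n) \<Rightarrow> (real \<Rightarrow> real) set \<Rightarrow> bool" where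
  "forward_complete f \<U> \<longleftrightarrow>
     (\<forall>x0. \<forall>I\<in>\<U>. \<exists>x. trajectory f I x0 x \<and>
        (\<forall>y. trajectory f I x0 y \<longrightarrow> (\<forall>t\<ge>0. y t = x t)))"

definition globally_dISS ::
  "(real^'n \<Rightarrow> real \<Rightarrow> real^'n) \<Rightarrow> (real \<Rightarrow> real) set \<Rightarrow> bool" where
  "globally_dISS f \<U> \<longleftrightarrow>
     (\<exists>\<beta> \<gamma>. class_KL \<beta> \<and> class_K_inf \<gamma> \<and>
        (\<forall>xa0 xb0. \<forall>Ia\<in>\<U>. \<forall>Ib\<in>\<U>. \<forall>xa xb.
           trajectory f Ia xa0 xa \<longrightarrow> trajectory f Ib xb0 xb \<longrightarrow>
           (\<forall>t\<ge>0. norm (xa t - xb t) \<le>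
              \<beta> (norm (xa0 - xb0)) t + \<gamma> (ess_sup_upto t (\<lambda>s. \<bar>Ia s - Ib s\<bar>)))))"

text \<open>Fading memory from the input I to the output y(t) = h(x(t), I(t)).\<close>

definition fading_memory ::
  "(real^'n \<Rightarrow> real \<Rightarrow> real^'n) \<Rightarrow> (real \<Rightarrow> real) set \<Rightarrow>
   (real^'n \<Rightarrow> real \<Rightarrow> 'y::real_normed_vector) \<Rightarrow> (real^'n) set \<Rightarrow> bool" where
  "fading_memory f \<U> h X0 \<longleftrightarrow>
     (\<exists>\<beta> \<gamma> w. class_KL \<beta> \<and> class_K_inf \<gamma> \<and> memory_kernel w \<and>
        (\<forall>xa0\<in>X0. \<forall>xb0\<in>X0. \<forall>Ia\<in>\<U>. \<forall>Ib\<in>\<U>. \<forall>xa xb.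
           trajectory f Ia xa0 xa \<longrightarrow> trajectory f Ib xb0 xb \<longrightarrow>
           (\<forall>t\<ge>0. norm (h (xa t) (Ia t) - h (xb t) (Ib t)) \<le>
              \<beta> (norm (xa0 - xb0)) t +
              \<gamma> (ess_sup_upto t (\<lambda>s. w (t - s) * \<bar>Ia s - Ib s\<bar>)))))"

definition fading_memory_on_compacts ::
  "(real^'n \<Rightarrow> real \<Rightarrow> real^'n) \<Rightarrow> (real \<Rightarrow> real) set \<Rightarrow>
   (real^'n \<Rightarrow> real \<Rightarrow> 'y::real_normed_vector) \<Rightarrow> bool" where
  "fading_memory_on_compacts f \<U> h \<longleftrightarrow> (\<forall>X0. compact X0 \<longrightarrow> fading_memory f \<U> h X0)"

end

(*
  Admissible inputs can be shifted in time, so delta-ISS can be applied on the window [t - tau, t],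
  where the difference of the inputs is at most v * exp tau for v = esssup exp(-(t - s)) |Ia - Ib|.
  Equibounded inputs keep the state difference below a constant R, and the choice
  exp tau = 1 / sqrt v bounds it by beta R tau + gamma (sqrt v), which vanishes as v tends to 0.
  If tau > t, the window [0, t] serves, and if v >= 1, the bound R does.

  For the output, M is Lipschitz but possibly unbounded, so the states themselves have to stay
  bounded. The estimate for pairs of trajectories yields this: at a suitable time T the flow is a
  contraction up to an additive constant, hence some ball is mapped into itself.
*)

theory Submission
  imports Defs
begin

section \<open>Comparison functions and the exponential kernel\<close>

lemma class_K_mono:
  assumes "class_K \<alpha>" "0 \<le> r" "r \<le> s"
  shows "\<alpha> r \<le> \<alpha> s"
  using assms by (cases "r = s") (auto simp: class_K_def strict_mono_on_def less_le)

lemma class_K_nonneg: "class_K \<alpha> \<Longrightarrow> 0 \<le> r \<Longrightarrow> 0 \<le> \<alpha> r"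
  using class_K_mono[of \<alpha> 0 r] by (simp add: class_K_def)

lemma class_KL_mono:
  assumes "class_KL \<beta>" "0 \<le> r" "r \<le> r'" "0 \<le> s'" "s' \<le> s"
  shows "\<beta> r s \<le> \<beta> r' s'"
proof -
  have "\<beta> r s \<le> \<beta> r s'"
    using assms by (auto simp: class_KL_def monotone_on_def)
  also have "\<dots> \<le> \<beta> r' s'"
    using assms class_K_mono[of "\<lambda>r. \<beta> r s'"] by (auto simp: class_KL_def)
  finally show ?thesis .
qed

lemma class_KL_zero: "class_KL \<beta> \<Longrightarrow> 0 \<le> s \<Longrightarrow> \<beta> 0 s = 0"
  by (simp add: class_KL_def class_K_def)

lemma class_KL_nonneg: "class_KL \<beta> \<Longrightarrow> 0 \<le> r \<Longrightarrow> 0 \<le> s \<Longrightarrow> 0 \<le> \<beta> r s"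
  using class_KL_mono[of \<beta> 0 r s s] by (simp add: class_KL_zero)

lemma class_KL_scale:
  assumes "class_KL \<beta>" "0 < c"
  shows "class_KL (\<lambda>r s. c * \<beta> r s)"
proof -
  have "((\<lambda>s. c * \<beta> r s) \<longlongrightarrow> 0) at_top" if "0 \<le> r" for r
    using assms that tendsto_mult_right_zero[of "\<beta> r" at_top c] by (simp add: class_KL_def)
  then show ?thesis
    using assms unfolding class_KL_def class_K_def
    by (auto simp: case_prod_beta strict_mono_on_def monotone_on_def intro!: continuous_intros)
qed

text \<open>The gain of the output has this shape: the \<open>\<kappa>\<close> summand carries the
  state difference, the linear one the input difference times a bound on the memristance.\<close>

lemma class_K_inf_scale_add:
  assumes "class_K_inf \<kappa>" "0 < c" "0 \<le> d"
  shows "class_K_inf (\<lambda>r. c * \<kappa> r + d * r)"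
proof -
  have "filterlim (\<lambda>r. c * \<kappa> r) at_top at_top"
    using assms by (auto simp: class_K_inf_def intro!: filterlim_tendsto_pos_mult_at_top[OF tendsto_const])
  moreover have "eventually (\<lambda>r. c * \<kappa> r \<le> c * \<kappa> r + d * r) at_top"
    using eventually_ge_at_top[of "0::real"] by eventually_elim (use assms in simp)
  ultimately have "filterlim (\<lambda>r. c * \<kappa> r + d * r) at_top at_top"
    by (rule filterlim_at_top_mono)
  moreover have "c * \<kappa> r + d * r < c * \<kappa> s + d * s" if "0 \<le> r" "r < s" for r s
    using assms that
    by (intro add_less_le_mono mult_strict_left_mono mult_left_mono)
       (auto simp: class_K_inf_def class_K_def strict_mono_on_def)
  ultimately show ?thesis
    using assms
    by (auto simp: class_K_inf_def class_K_def strict_mono_on_def intro!: continuous_intros)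
qed

lemma memory_kernel_exp: "memory_kernel (\<lambda>s. exp (- s))"
proof -
  have "((\<lambda>s::real. exp (- s)) \<longlongrightarrow> 0) at_top"
    by (intro filterlim_compose[OF exp_at_bot] filterlim_uminus_at_bot_at_top)
  then show ?thesis
    by (auto simp: memory_kernel_def monotone_on_def intro!: continuous_intros)
qed

text \<open>One gain has to absorb every bound that occurs. With exp tau = 1 / sqrt v, the term beta
  R tau is nondecreasing in v and vanishes with v, because tau grows as v shrinks. It need not be
  strictly increasing; adding \<open>(R + 1) * v\<close> makes the sum strictly increasing and
  unbounded, and at least \<open>R\<close> once v >= 1.\<close>

lemma fading_gain_exists:
  assumes KL: "class_KL \<beta>" and K: "class_K_inf \<gamma>" and R: "0 \<le> R"
  obtains \<kappa> where "class_K_inf \<kappa>"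
    and "\<And>v. 0 < v \<Longrightarrow> v < 1 \<Longrightarrow> \<beta> R (- ln (sqrt v)) + \<gamma> (sqrt v) \<le> \<kappa> v"
    and "\<And>v. 1 \<le> v \<Longrightarrow> R \<le> \<kappa> v"
proof
  \<comment> \<open>The truncation at 0 keeps the time argument of \<open>\<beta>\<close>
    nonnegative when v > 1. The value of \<open>b\<close> at 0 is set to its limit there.\<close>
  define \<tau> where "\<tau> v = max 0 (- ln (sqrt v))" for v :: real
  define b where "b v = (if v \<le> 0 then 0 else \<beta> R (\<tau> v))" for v
  define \<kappa> where "\<kappa> v = b v + \<gamma> (sqrt v) + (R + 1) * v" for v
  have \<tau>0: "0 \<le> \<tau> v" for v by (simp add: \<tau>_def)
  have b0: "0 \<le> b v" for v
    using class_KL_nonneg[OF KL R \<tau>0] by (simp add: b_def)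
  have b_mono: "b u \<le> b v" if "0 \<le> u" "u \<le> v" for u v
  proof (cases "u = 0")
    case True
    then show ?thesis using b0 by (simp add: b_def)
  next
    case False
    then have "\<tau> v \<le> \<tau> u" using that unfolding \<tau>_def by (intro max.mono) auto
    then show ?thesis
      using False that class_KL_mono[OF KL R order_refl \<tau>0] by (auto simp: b_def)
  qed
  have KLc: "continuous_on ({0..} \<times> {0..}) (\<lambda>(r, s). \<beta> r s)"
    using KL by (simp add: class_KL_def)
  have "continuous_on {0<..} (\<lambda>v. (\<lambda>(r, s). \<beta> r s) (R, \<tau> v))"
    unfolding \<tau>_def using R
    by (intro continuous_on_compose2[OF KLc] continuous_intros) auto
  then have "continuous_on {0<..} b"
    by (rule continuous_on_eq) (auto simp: b_def)
  then have b_pos: "isCont b v" if "0 < v" for v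
    using that by (simp add: continuous_on_eq_continuous_at)
  \<comment> \<open>Continuity at 0 is one-sided: \<open>\<tau> v\<close> tends to infinity as v
    decreases to 0, and \<open>\<beta> R\<close> decays.\<close>
  have "filterlim (\<lambda>v. - ln (sqrt v)) at_top (at_right 0)"
    by real_asymp
  then have "filterlim \<tau> at_top (at_right 0)"
    by (rule filterlim_at_top_mono) (simp add: \<tau>_def)
  moreover have "(\<beta> R \<longlongrightarrow> 0) at_top" using KL R by (simp add: class_KL_def)
  ultimately have "((\<lambda>v. \<beta> R (\<tau> v)) \<longlongrightarrow> 0) (at_right 0)"
    by (rule filterlim_compose[rotated])
  then have "(b \<longlongrightarrow> 0) (at_right 0)"
    by (rule Lim_transform_eventually) (simp add: b_def eventually_at_right_less eventually_at_filter)
  then have b_zero: "continuous (at 0 within {0..}) b"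
    by (simp add: continuous_within at_within_Ici_at_right b_def)
  have b_cont: "continuous_on {0..} b"
    unfolding continuous_on_eq_continuous_within
  proof
    fix v :: real assume "v \<in> {0..}"
    then show "continuous (at v within {0..}) b"
      using b_pos[of v] b_zero by (cases "v = 0") (auto intro: continuous_at_imp_continuous_at_within)
  qed
  have \<gamma>: "class_K \<gamma>" using K by (simp add: class_K_inf_def)
  have \<gamma>c: "continuous_on {0..} (\<lambda>v. \<gamma> (sqrt v))"
    using \<gamma> by (auto simp: class_K_def intro!: continuous_on_compose2[of "{0..}" \<gamma> "{0..}" sqrt] continuous_intros)
  have \<kappa>_ge: "(R + 1) * v \<le> \<kappa> v" if "0 \<le> v" for v
    using b0[of v] class_K_nonneg[OF \<gamma>, of "sqrt v"] that by (simp add: \<kappa>_def)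
  have "\<kappa> u < \<kappa> v" if "0 \<le> u" "u < v" for u v
    unfolding \<kappa>_def using that R
    by (intro add_le_less_mono add_mono b_mono class_K_mono[OF \<gamma>] mult_strict_left_mono) auto
  moreover have "continuous_on {0..} \<kappa>"
    unfolding \<kappa>_def by (intro continuous_intros b_cont \<gamma>c)
  moreover have "\<kappa> 0 = 0" using \<gamma> by (simp add: \<kappa>_def b_def class_K_def)
  moreover have "filterlim \<kappa> at_top at_top"
  proof (rule filterlim_at_top_mono[OF filterlim_ident])
    show "eventually (\<lambda>v. v \<le> \<kappa> v) at_top"
      using eventually_ge_at_top[of "0::real"]
    proof eventually_elim
      case (elim v)
      have "v \<le> (R + 1) * v" using R elim by (simp add: algebra_simps)
      then show ?case using \<kappa>_ge[OF elim] by linarith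
    qed
  qed
  ultimately show "class_K_inf \<kappa>"
    by (simp add: class_K_inf_def class_K_def strict_mono_on_def)
  show "\<beta> R (- ln (sqrt v)) + \<gamma> (sqrt v) \<le> \<kappa> v" if "0 < v" "v < 1" for v
    using that R by (simp add: \<kappa>_def b_def \<tau>_def max_def)
  show "R \<le> \<kappa> v" if "1 \<le> v" for v
  proof -
    have "R * 1 \<le> (R + 1) * v" using R that by (intro mult_mono) auto
    then show ?thesis using \<kappa>_ge[of v] that by simp
  qed
qed

section \<open>Null sets and essential suprema on intervals\<close>

lemma AE_lebesgue_on_iff_negligible:
  assumes "S \<in> sets lebesgue"
  shows "(AE x in lebesgue_on S. P x) \<longleftrightarrow> negligible {x \<in> S. \<not> P x}"
  using assms
  by (simp add: AE_restrict_space_iff completion.AE_iff_null_sets negligible_iff_null_sets)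

text \<open>Translations preserve negligible sets. This moves the window [t - tau, t] to [0, tau],
  the time axis of the shifted inputs.\<close>

lemma AE_lebesgue_on_interval_shift:
  fixes \<tau> t :: real
  assumes AE: "AE s in lebesgue_on {0..t}. P s" and "0 \<le> \<tau>" "\<tau> \<le> t"
  shows "AE s in lebesgue_on {0..\<tau>}. P (s + (t - \<tau>))"
proof -
  have "negligible {s \<in> {0..t}. \<not> P s}"
    using AE by (simp add: AE_lebesgue_on_iff_negligible)
  then have "negligible ((+) (\<tau> - t) ` {s \<in> {0..t}. \<not> P s})"
    by (rule negligible_translation)
  then have "negligible {s \<in> {0..\<tau>}. \<not> P (s + (t - \<tau>))}"
  proof (rule negligible_subset)
    show "{s \<in> {0..\<tau>}. \<not> P (s + (t - \<tau>))} \<subseteq> (+) (\<tau> - t) ` {s \<in> {0..t}. \<not> P s}"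
    proof
      fix s assume "s \<in> {s \<in> {0..\<tau>}. \<not> P (s + (t - \<tau>))}"
      then show "s \<in> (+) (\<tau> - t) ` {s \<in> {0..t}. \<not> P s}"
        using assms(3) by (intro image_eqI[of _ _ "s + (t - \<tau>)"]) auto
    qed
  qed
  then show ?thesis by (simp add: AE_lebesgue_on_iff_negligible)
qed

text \<open>A violation at the right end would persist, by continuity, on a left neighbourhood of
  \<open>b\<close>, which has positive measure.\<close>

lemma AE_Icc_le_imp_le_right_end:
  fixes g :: "real \<Rightarrow> real"
  assumes AE: "AE s in lebesgue_on {a..b}. g s \<le> v" and "a < b" and g: "continuous_on {a..b} g"
  shows "g b \<le> v"
proof (rule ccontr)
  assume "\<not> g b \<le> v"
  then have "0 < g b - v" by simp
  then obtain d where d: "0 < d" "\<And>s. s \<in> {a..b} \<Longrightarrow> dist s b < d \<Longrightarrow> dist (g s) (g b) < g b - v"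
    using g \<open>a < b\<close> unfolding continuous_on_iff by (metis atLeastAtMost_iff less_imp_le order_refl)
  have "{max a (b - d)<..<b} \<subseteq> {s \<in> {a..b}. \<not> g s \<le> v}"
  proof
    fix s assume "s \<in> {max a (b - d)<..<b}"
    then show "s \<in> {s \<in> {a..b}. \<not> g s \<le> v}"
      using d(2)[of s] by (auto simp: dist_real_def)
  qed
  then have "negligible {max a (b - d)<..<b}"
    using AE negligible_subset by (auto simp: AE_lebesgue_on_iff_negligible)
  then show False
    using \<open>a < b\<close> d(1) negligible_interval(2)[of "max a (b - d)" b] by auto
qed

text \<open>Since \<open>real_of_ereal\<close> sends minus infinity to 0, a nonnegative
  \<open>c\<close> makes the bound survive the conversion in every case. The point value at t = 0
  needs its own bound, as almost everywhere statements do not see it.\<close>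

lemma ess_sup_upto_le:
  assumes "g \<in> borel_measurable (lebesgue_on {0..t})" "0 \<le> c"
    and "t = 0 \<Longrightarrow> g 0 \<le> c" "AE s in lebesgue_on {0..t}. g s \<le> c"
  shows "ess_sup_upto t g \<le> c"
proof (cases "t = 0")
  case False
  have "esssup (lebesgue_on {0..t}) (\<lambda>s. ereal (g s)) \<le> ereal c"
    using assms by (intro esssup_I) auto
  then show ?thesis
    using False assms(2) 
    by (cases "esssup (lebesgue_on {0..t}) (\<lambda>s. ereal (g s))") (auto simp: ess_sup_upto_def)
qed (use assms in \<open>simp add: ess_sup_upto_def\<close>)

text \<open>The pointwise bounds make the essential supremum finite, so its conversion to a real
  loses nothing. That it is at least 0 rests on [0, t] having positive measure when t > 0.\<close>

lemma ess_sup_upto_bounds: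
  assumes g: "g \<in> borel_measurable (lebesgue_on {0..t})" and "0 \<le> t"
    and bound: "\<And>s. 0 \<le> s \<Longrightarrow> s \<le> t \<Longrightarrow> 0 \<le> g s \<and> g s \<le> C"
  shows "0 \<le> ess_sup_upto t g" "AE s in lebesgue_on {0..t}. g s \<le> ess_sup_upto t g"
proof -
  define E where "E = esssup (lebesgue_on {0..t}) (\<lambda>s. ereal (g s))"
  have AE: "AE s in lebesgue_on {0..t}. ereal (g s) \<le> E"
    unfolding E_def by (rule esssup_AE)
  have "0 \<le> ess_sup_upto t g \<and> (AE s in lebesgue_on {0..t}. g s \<le> ess_sup_upto t g)"
  proof (cases "t = 0")
    case True
    then show ?thesis
      using bound[of 0] by (auto simp: ess_sup_upto_def intro!: AE_I2)
  next
    case False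
    have "esssup (lebesgue_on {0..t}) (\<lambda>s. 0 :: ereal) \<le> E"
      unfolding E_def using bound by (intro esssup_AE_mono AE_I2) auto
    moreover have "emeasure (lebesgue_on {0..t}) (space (lebesgue_on {0..t})) \<noteq> 0"
      using False \<open>0 \<le> t\<close> by (simp add: emeasure_restrict_space)
    ultimately have "0 \<le> E"
      by (simp add: esssup_const)
    moreover have "E \<le> ereal C"
      unfolding E_def using g bound by (intro esssup_I AE_I2) auto
    ultimately obtain e where "E = ereal e" "0 \<le> e"
      by (cases E) auto
    then show ?thesis
      using AE False by (simp add: ess_sup_upto_def flip: E_def)
  qed
  then show "0 \<le> ess_sup_upto t g" "AE s in lebesgue_on {0..t}. g s \<le> ess_sup_upto t g"
    by auto
qed

section \<open>Trajectories in integral form\<close>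

lemma trajectory_init: "trajectory f I x0 x \<Longrightarrow> x 0 = x0"
proof -
  assume "trajectory f I x0 x"
  then have "x 0 = x0 + (LINT s:{0..0}|lebesgue. f (x s) (I s))"
    unfolding trajectory_def by (metis order_refl)
  moreover have "(LINT s:{0..0}|lebesgue. f (x s) (I s)) = integral {0..0} (\<lambda>s. f (x s) (I s))"
    using \<open>trajectory f I x0 x\<close> unfolding trajectory_def
    by (intro set_lebesgue_integral_eq_integral) (metis order_refl)
  ultimately show ?thesis by simp
qed

text \<open>The integral is split at \<open>\<sigma>\<close> and its tail is translated to start at
  time 0. All integrals run over nonnegative times, where \<open>J\<close> is known.\<close>

lemma trajectory_shift:
  assumes x: "trajectory f I x0 x" and "0 \<le> \<sigma>" and J: "\<And>s. 0 \<le> s \<Longrightarrow> J s = I (s + \<sigma>)"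
  shows "trajectory f J (x \<sigma>) (\<lambda>s. x (s + \<sigma>))"
  unfolding trajectory_def
proof (intro allI impI)
  fix t :: real assume "0 \<le> t"
  define g where "g s = f (x s) (I s)" for s
  have int: "set_integrable lebesgue {0..u} g" and x_eq: "x u = x0 + (LINT s:{0..u}|lebesgue. g s)"
    if "0 \<le> u" for u
    using x that by (auto simp: trajectory_def g_def[abs_def])
  have int': "set_integrable lebesgue {\<sigma>..t + \<sigma>} g"
    using \<open>0 \<le> \<sigma>\<close> \<open>0 \<le> t\<close> by (intro set_integrable_subset[OF int[of "t + \<sigma>"]]) auto
  define i where "i = (LINT s:{\<sigma>..t + \<sigma>}|lebesgue. g s)"
  have "has_bochner_integral lebesgue (\<lambda>s. indicator {\<sigma>..t + \<sigma>} s *\<^sub>R g s) i"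
    using int' by (simp add: has_bochner_integral_iff i_def set_integrable_def set_lebesgue_integral_def)
  \<comment> \<open>Affine substitution with slope 1 and offset \<open>\<sigma>\<close>.\<close>
  then have "has_bochner_integral lebesgue
      (\<lambda>s. indicator {\<sigma>..t + \<sigma>} (\<sigma> + 1 * s) *\<^sub>R g (\<sigma> + 1 * s)) (i /\<^sub>R \<bar>1\<bar>)"
    by (subst (asm) has_bochner_integral_lebesgue_real_affine_iff[of 1 _ _ \<sigma>]) auto
  moreover have "(\<lambda>s. indicator {\<sigma>..t + \<sigma>} (\<sigma> + 1 * s) *\<^sub>R g (\<sigma> + 1 * s))
      = (\<lambda>s. indicator {0..t} s *\<^sub>R f (x (s + \<sigma>)) (J s))"
    by (auto simp: g_def J indicator_def add.commute)
  ultimately have "has_bochner_integral lebesgue (\<lambda>s. indicator {0..t} s *\<^sub>R f (x (s + \<sigma>)) (J s)) i"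
    by simp
  then have *: "set_integrable lebesgue {0..t} (\<lambda>s. f (x (s + \<sigma>)) (J s))"
    "(LINT s:{0..t}|lebesgue. f (x (s + \<sigma>)) (J s)) = i"
    by (simp_all add: has_bochner_integral_iff set_integrable_def set_lebesgue_integral_def)
  have "integral {0..t + \<sigma>} g = integral {0..\<sigma>} g + integral {\<sigma>..t + \<sigma>} g"
    using int[of "t + \<sigma>"] \<open>0 \<le> \<sigma>\<close> \<open>0 \<le> t\<close>
    by (intro Henstock_Kurzweil_Integration.integral_combine[symmetric])
       (auto simp: set_lebesgue_integral_eq_integral(1))
  then have "x (t + \<sigma>) = x \<sigma> + i"
    using int int' x_eq \<open>0 \<le> \<sigma>\<close> \<open>0 \<le> t\<close>
    by (simp add: set_lebesgue_integral_eq_integral(2) i_def)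
  with * show "set_integrable lebesgue {0..t} (\<lambda>s. f (x (s + \<sigma>)) (J s)) \<and>
      x (t + \<sigma>) = x \<sigma> + (LINT s:{0..t}|lebesgue. f (x (s + \<sigma>)) (J s))"
    by simp
qed

text \<open>The integral of the norm of the velocity up to \<open>T\<close> dominates every
  displacement before \<open>T\<close>. It serves to bound a reference trajectory over one
  period.\<close>

lemma trajectory_bounded_on_interval:
  fixes x :: "real \<Rightarrow> real^'n"
  assumes x: "trajectory f I x0 x"
  obtains B where "0 \<le> B" "\<And>s. 0 \<le> s \<Longrightarrow> s \<le> T \<Longrightarrow> norm (x s - x0) \<le> B"
proof
  define g where "g s = f (x s) (I s)" for s
  define B where "B = (LINT s:{0..T}|lebesgue. norm (g s))"
  show "0 \<le> B"
    unfolding B_def set_lebesgue_integral_def by (intro integral_nonneg_AE) auto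
  fix s assume s: "0 \<le> s" "s \<le> T"
  then have int: "set_integrable lebesgue {0..s} g" "set_integrable lebesgue {0..T} g"
    and "x s = x0 + (LINT s:{0..s}|lebesgue. g s)"
    using x by (auto simp: trajectory_def g_def[abs_def])
  then have "norm (x s - x0) \<le> (LINT s:{0..s}|lebesgue. norm (g s))"
    using set_integral_norm_bound[OF int(1)] by simp
  also have "\<dots> \<le> B"
    unfolding B_def set_lebesgue_integral_def
    using s set_integrable_norm[OF int(1)] set_integrable_norm[OF int(2)]
    by (intro integral_mono) (auto simp: set_integrable_def indicator_def)
  finally show "norm (x s - x0) \<le> B" .
qed

section \<open>Consequences of the delta-ISS estimate for a fixed choice of its witnesses\<close>

locale dISS_system =
  fixes f :: "real^'n \<Rightarrow> real \<Rightarrow> real^'n" and \<U> :: "(real \<Rightarrow> real) set"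
    and \<beta> :: "real \<Rightarrow> real \<Rightarrow> real" and \<gamma> :: "real \<Rightarrow> real" and Ibar :: real
  assumes L_infinity: "\<U> \<subseteq> L_infinity"
    and shift: "shift_closed \<U>"
    and Ibar_pos: "0 < Ibar"
    and Ibar: "\<And>I t. I \<in> \<U> \<Longrightarrow> 0 \<le> t \<Longrightarrow> \<bar>I t\<bar> \<le> Ibar"
    and complete: "forward_complete f \<U>"
    and KL: "class_KL \<beta>"
    and K_inf: "class_K_inf \<gamma>"
    and dISS: "\<And>xa0 xb0 Ia Ib xa xb t. Ia \<in> \<U> \<Longrightarrow> Ib \<in> \<U> \<Longrightarrow>
      trajectory f Ia xa0 xa \<Longrightarrow> trajectory f Ib xb0 xb \<Longrightarrow> 0 \<le> t \<Longrightarrow>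
      norm (xa t - xb t) \<le> \<beta> (norm (xa0 - xb0)) t + \<gamma> (ess_sup_upto t (\<lambda>s. \<bar>Ia s - Ib s\<bar>))"
begin

lemma K: "class_K \<gamma>"
  using K_inf by (simp add: class_K_inf_def)

lemma input_diff_le: "Ia \<in> \<U> \<Longrightarrow> Ib \<in> \<U> \<Longrightarrow> 0 \<le> s \<Longrightarrow> \<bar>Ia s - Ib s\<bar> \<le> 2 * Ibar"
  using Ibar[of Ia s] Ibar[of Ib s] by linarith

lemma input_measurable:
  assumes "I \<in> \<U>"
  shows "I \<in> borel_measurable (lebesgue_on {0..t})"
proof -
  have "I \<in> borel_measurable (lebesgue_on {0..})"
    using assms L_infinity by (auto simp: L_infinity_def)
  then show ?thesis
    by (rule measurable_restrict_mono) auto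
qed

text \<open>By monotonicity of \<open>\<gamma>\<close>, any almost everywhere bound on the input
  difference may take the place of the essential supremum.\<close>

lemma dISS_le:
  assumes I: "Ia \<in> \<U>" "Ib \<in> \<U>" and x: "trajectory f Ia xa0 xa" "trajectory f Ib xb0 xb"
    and "0 \<le> t" "0 \<le> c" "t = 0 \<Longrightarrow> \<bar>Ia 0 - Ib 0\<bar> \<le> c"
    and AE: "AE s in lebesgue_on {0..t}. \<bar>Ia s - Ib s\<bar> \<le> c"
  shows "norm (xa t - xb t) \<le> \<beta> (norm (xa0 - xb0)) t + \<gamma> c"
proof -
  note [measurable] = input_measurable[OF I(1)] input_measurable[OF I(2)]
  have meas: "(\<lambda>s. \<bar>Ia s - Ib s\<bar>) \<in> borel_measurable (lebesgue_on {0..t})"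
    by measurable
  \<comment> \<open>Monotonicity of \<open>\<gamma>\<close> is available on nonnegative arguments
    only.\<close>
  have "0 \<le> ess_sup_upto t (\<lambda>s. \<bar>Ia s - Ib s\<bar>)"
    using input_diff_le[OF I] \<open>0 \<le> t\<close> by (intro ess_sup_upto_bounds(1)[OF meas]) auto
  moreover have "ess_sup_upto t (\<lambda>s. \<bar>Ia s - Ib s\<bar>) \<le> c"
    using assms by (intro ess_sup_upto_le meas) auto
  ultimately show ?thesis
    using dISS[OF I x \<open>0 \<le> t\<close>] class_K_mono[OF K] by fastforce
qed

lemma state_diff_bounded:
  assumes I: "Ia \<in> \<U>" "Ib \<in> \<U>" and x: "trajectory f Ia xa0 xa" "trajectory f Ib xb0 xb"
    and "0 \<le> t"
  shows "norm (xa t - xb t) \<le> \<beta> (norm (xa0 - xb0)) t + \<gamma> (2 * Ibar)"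
  using assms Ibar_pos input_diff_le[OF I] by (intro dISS_le[OF I x] AE_I2) auto

lemma state_diff_same_input:
  assumes "I \<in> \<U>" "trajectory f I xa0 xa" "trajectory f I xb0 xb" "0 \<le> t"
  shows "norm (xa t - xb t) \<le> \<beta> (norm (xa0 - xb0)) t"
proof -
  have "norm (xa t - xb t) \<le> \<beta> (norm (xa0 - xb0)) t + \<gamma> 0"
    using assms by (intro dISS_le[OF assms(1,1)]) auto
  then show ?thesis using K by (simp add: class_K_def)
qed

lemma shifted_input:
  assumes "I \<in> \<U>" "trajectory f I x0 x" "0 \<le> \<sigma>"
  obtains J where "J \<in> \<U>" "\<And>s. 0 \<le> s \<Longrightarrow> J s = I (s + \<sigma>)"
    "trajectory f J (x \<sigma>) (\<lambda>s. x (s + \<sigma>))"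
proof -
  obtain J where J: "J \<in> \<U>" "\<And>s. 0 \<le> s \<Longrightarrow> J s = I (s + \<sigma>)"
    using shift assms by (metis shift_closed_def)
  with trajectory_shift[OF assms(2,3), of J] that show ?thesis by blast
qed

section \<open>The exponentially weighted input difference and windows ending at t\<close>

abbreviation faded_diff :: "(real \<Rightarrow> real) \<Rightarrow> (real \<Rightarrow> real) \<Rightarrow> real \<Rightarrow> real" where
  "faded_diff Ia Ib t \<equiv> ess_sup_upto t (\<lambda>s. exp (- (t - s)) * \<bar>Ia s - Ib s\<bar>)"

lemma faded_diff_bounds:
  assumes I: "Ia \<in> \<U>" "Ib \<in> \<U>" and "0 \<le> t"
  shows "0 \<le> faded_diff Ia Ib t"
    and "AE s in lebesgue_on {0..t}. exp (- (t - s)) * \<bar>Ia s - Ib s\<bar> \<le> faded_diff Ia Ib t"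
proof -
  note [measurable] = input_measurable[OF I(1)] input_measurable[OF I(2)]
  have "(\<lambda>s. exp (- (t - s))) \<in> borel_measurable (lebesgue_on {0..t})"
    by (intro continuous_imp_measurable_on_sets_lebesgue continuous_intros) auto
  then have meas: "(\<lambda>s. exp (- (t - s)) * \<bar>Ia s - Ib s\<bar>) \<in> borel_measurable (lebesgue_on {0..t})"
    by measurable
  have "0 \<le> exp (- (t - s)) * \<bar>Ia s - Ib s\<bar> \<and> exp (- (t - s)) * \<bar>Ia s - Ib s\<bar> \<le> 1 * (2 * Ibar)"
    if "0 \<le> s" "s \<le> t" for s
    using that input_diff_le[OF I, of s] by (intro conjI mult_mono) auto
  from ess_sup_upto_bounds[OF meas \<open>0 \<le> t\<close> this]
  show "0 \<le> faded_diff Ia Ib t"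
    "AE s in lebesgue_on {0..t}. exp (- (t - s)) * \<bar>Ia s - Ib s\<bar> \<le> faded_diff Ia Ib t"
    by auto
qed

lemma window_estimate:
  assumes I: "Ia \<in> \<U>" "Ib \<in> \<U>" and x: "trajectory f Ia xa0 xa" "trajectory f Ib xb0 xb"
    and \<tau>: "0 \<le> \<tau>" "\<tau> \<le> t" "\<tau> = 0 \<Longrightarrow> t = 0"
  shows "norm (xa t - xb t) \<le>
    \<beta> (norm (xa (t - \<tau>) - xb (t - \<tau>))) \<tau> + \<gamma> (faded_diff Ia Ib t * exp \<tau>)"
proof -
  have t: "0 \<le> t" "0 \<le> t - \<tau>" using \<tau> by auto
  obtain Ja where Ja: "Ja \<in> \<U>" "\<And>s. 0 \<le> s \<Longrightarrow> Ja s = Ia (s + (t - \<tau>))"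
    "trajectory f Ja (xa (t - \<tau>)) (\<lambda>s. xa (s + (t - \<tau>)))"
    using shifted_input[OF I(1) x(1) t(2)] by blast
  obtain Jb where Jb: "Jb \<in> \<U>" "\<And>s. 0 \<le> s \<Longrightarrow> Jb s = Ib (s + (t - \<tau>))"
    "trajectory f Jb (xb (t - \<tau>)) (\<lambda>s. xb (s + (t - \<tau>)))"
    using shifted_input[OF I(2) x(2) t(2)] by blast
  have le: "\<bar>Ia s - Ib s\<bar> \<le> faded_diff Ia Ib t * exp \<tau>"
    if *: "exp (- (t - s)) * \<bar>Ia s - Ib s\<bar> \<le> faded_diff Ia Ib t" and s: "t - \<tau> \<le> s" for s
  proof -
    have "\<bar>Ia s - Ib s\<bar> = exp (- (t - s)) * \<bar>Ia s - Ib s\<bar> * exp (t - s)"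
      by (simp add: mult.commute mult.left_commute flip: exp_add)
    also have "\<dots> \<le> faded_diff Ia Ib t * exp \<tau>"
      using * s faded_diff_bounds(1)[OF I t(1)] by (intro mult_mono) auto
    finally show ?thesis .
  qed
  have "AE s in lebesgue_on {0..\<tau>}. exp (- (t - (s + (t - \<tau>)))) *
      \<bar>Ia (s + (t - \<tau>)) - Ib (s + (t - \<tau>))\<bar> \<le> faded_diff Ia Ib t"
    by (rule AE_lebesgue_on_interval_shift[OF faded_diff_bounds(2)[OF I t(1)] \<tau>(1,2)])
  moreover have "AE s in lebesgue_on {0..\<tau>}. 0 \<le> s"
    by (intro AE_I2) auto
  ultimately have "AE s in lebesgue_on {0..\<tau>}. \<bar>Ja s - Jb s\<bar> \<le> faded_diff Ia Ib t * exp \<tau>"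
    by eventually_elim (use le Ja(2) Jb(2) in simp)
  \<comment> \<open>Here t = 0 as well, the weight is 1, and \<open>ess_sup_upto\<close> is the
    point value.\<close>
  moreover have "\<bar>Ja 0 - Jb 0\<bar> \<le> faded_diff Ia Ib t * exp \<tau>" if "\<tau> = 0"
    using that \<tau>(3) Ja(2)[of 0] Jb(2)[of 0] by (simp add: ess_sup_upto_def)
  ultimately have "norm (xa (\<tau> + (t - \<tau>)) - xb (\<tau> + (t - \<tau>))) \<le>
      \<beta> (norm (xa (t - \<tau>) - xb (t - \<tau>))) \<tau> + \<gamma> (faded_diff Ia Ib t * exp \<tau>)"
    using faded_diff_bounds(1)[OF I t(1)] \<tau>(1)
    by (intro dISS_le[OF Ja(1) Jb(1) Ja(3) Jb(3)]) auto
  then show ?thesis by simp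
qed

text \<open>Only the gain depends on \<open>D\<close>, through the bound \<open>R\<close> on all
  state differences; \<open>\<beta>\<close> is kept unchanged.\<close>

lemma state_fading_gain:
  assumes "0 \<le> D"
  obtains \<kappa> where "class_K_inf \<kappa>"
    and "\<And>xa0 xb0 Ia Ib xa xb t. Ia \<in> \<U> \<Longrightarrow> Ib \<in> \<U> \<Longrightarrow>
      trajectory f Ia xa0 xa \<Longrightarrow> trajectory f Ib xb0 xb \<Longrightarrow> norm (xa0 - xb0) \<le> D \<Longrightarrow> 0 \<le> t \<Longrightarrow>
      norm (xa t - xb t) \<le> \<beta> (norm (xa0 - xb0)) t + \<kappa> (faded_diff Ia Ib t)"
proof -
  define R where "R = \<beta> D 0 + \<gamma> (2 * Ibar)"
  have R0: "0 \<le> R"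
    using assms Ibar_pos class_KL_nonneg[OF KL] class_K_nonneg[OF K] by (simp add: R_def)
  obtain \<kappa> where \<kappa>: "class_K_inf \<kappa>"
    and small: "\<And>v. 0 < v \<Longrightarrow> v < 1 \<Longrightarrow> \<beta> R (- ln (sqrt v)) + \<gamma> (sqrt v) \<le> \<kappa> v"
    and large: "\<And>v. 1 \<le> v \<Longrightarrow> R \<le> \<kappa> v"
    using fading_gain_exists[OF KL K_inf R0] by blast
  show thesis
  proof (rule that[OF \<kappa>])
    fix xa0 xb0 Ia Ib xa xb and t :: real
    assume I: "Ia \<in> \<U>" "Ib \<in> \<U>" and x: "trajectory f Ia xa0 xa" "trajectory f Ib xb0 xb"
      and D: "norm (xa0 - xb0) \<le> D" and "0 \<le> t"
    define v where "v = faded_diff Ia Ib t"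
    have v0: "0 \<le> v" using faded_diff_bounds[OF I \<open>0 \<le> t\<close>] by (simp add: v_def)
    have e_R: "norm (xa s - xb s) \<le> R" if "0 \<le> s" for s
      using state_diff_bounded[OF I x that] class_KL_mono[OF KL norm_ge_zero D order_refl that]
      by (simp add: R_def)
    have whole: "norm (xa t - xb t) \<le> \<beta> (norm (xa0 - xb0)) t + \<gamma> (v * exp t)"
      using window_estimate[OF I x, of t t] \<open>0 \<le> t\<close> trajectory_init[OF x(1)] trajectory_init[OF x(2)]
      by (simp add: v_def)
    have \<beta>0: "0 \<le> \<beta> (norm (xa0 - xb0)) t"
      using class_KL_nonneg[OF KL] \<open>0 \<le> t\<close> by simp
    consider "v = 0" | "0 < v" "v < 1" | "1 \<le> v" using v0 by linarith
    then have "norm (xa t - xb t) \<le> \<beta> (norm (xa0 - xb0)) t + \<kappa> v"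
    proof cases
      \<comment> \<open>The whole window [0, t] suffices, since the input term becomes
        \<open>\<gamma> 0\<close>.\<close>
      case 1
      then show ?thesis using whole K \<kappa> by (simp add: class_K_inf_def class_K_def)
    next
      case 2
      define \<tau> where "\<tau> = - ln (sqrt v)"
      have \<tau>: "0 < \<tau>" using 2 by (simp add: \<tau>_def)
      have "v * exp \<tau> = v / sqrt v"
        using 2 by (simp add: \<tau>_def exp_minus divide_inverse)
      also have "\<dots> = sqrt v"
        using 2 by (simp add: real_div_sqrt)
      finally have v_exp: "v * exp \<tau> = sqrt v" .
      show ?thesis
      proof (cases "\<tau> \<le> t")
        case True
        have "norm (xa t - xb t) \<le> \<beta> (norm (xa (t - \<tau>) - xb (t - \<tau>))) \<tau> + \<gamma> (sqrt v)"
          using window_estimate[OF I x, of \<tau> t] \<tau> True v_exp by (simp add: v_def)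
        also have "\<dots> \<le> \<beta> R \<tau> + \<gamma> (sqrt v)"
          using e_R[of "t - \<tau>"] \<tau> True by (intro add_right_mono class_KL_mono[OF KL]) auto
        also have "\<dots> \<le> \<kappa> v" using small[OF 2] by (simp add: \<tau>_def)
        finally show ?thesis using \<beta>0 by linarith
      next
        case False
        \<comment> \<open>The preferred window would start before time 0. On [0, t] the factor is
          even smaller, as exp t < exp tau.\<close>
        have "v * exp t \<le> v * exp \<tau>" using v0 False by (intro mult_left_mono) auto
        then have "\<gamma> (v * exp t) \<le> \<gamma> (sqrt v)"
          using v0 v_exp by (intro class_K_mono[OF K]) auto
        also have "\<dots> \<le> \<kappa> v"
          using small[OF 2] class_KL_nonneg[OF KL R0, of \<tau>] \<tau> by (simp add: \<tau>_def)
        finally show ?thesis using whole by linarith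
      qed
    next
      case 3
      then show ?thesis using e_R[OF \<open>0 \<le> t\<close>] large \<beta>0 by fastforce
    qed
    then show "norm (xa t - xb t) \<le> \<beta> (norm (xa0 - xb0)) t + \<kappa> (faded_diff Ia Ib t)"
      by (simp add: v_def)
  qed
qed

section \<open>Boundedness of the states, uniformly in time and input\<close>

text \<open>
  Subdividing the segment between the initial states into pieces of length at most 1 turns the
  decay of \<open>\<beta> 1\<close> into a contraction at large distances, no matter how slowly \<open>\<beta> r\<close>
  decays for large \<open>r\<close>.
\<close>

lemma coarse_contraction:
  assumes T: "0 \<le> T" "\<beta> 1 T \<le> 1/2" and I: "I \<in> \<U>"
    and x: "trajectory f I xa0 xa" "trajectory f I xb0 xb"
  shows "norm (xa T - xb T) \<le> (norm (xa0 - xb0) + 1) / 2"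
proof -
  \<comment> \<open>A chain of n pieces of length at most 1 ends with n gaps of at most 1/2. The end
    \<open>xb0\<close> stays fixed while \<open>xa0\<close> moves towards it.\<close>
  have chain: "norm (xa T - xb T) \<le> real n / 2"
    if "norm (xa0 - xb0) \<le> real n" "trajectory f I xa0 xa" "trajectory f I xb0 xb" for n xa0 xb0 xa xb
    using that
  proof (induction n arbitrary: xa0 xa)
    case 0
    then have "norm (xa0 - xb0) = 0" by simp
    with state_diff_same_input[OF I 0(2,3) T(1)] class_KL_zero[OF KL T(1)]
    show ?case by (simp only: of_nat_0 div_0)
  next
    case (Suc n)
    \<comment> \<open>The intermediate state \<open>c\<close> cuts off the first of n + 1 equal
      pieces, so it is within 1 of \<open>xa0\<close> and within n of \<open>xb0\<close>.\<close>
    define a where "a = 1 / real (Suc n)"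
    have a: "0 \<le> a" "a \<le> 1" "a * real (Suc n) = 1"
      by (auto simp: a_def)
    define c where "c = xa0 + a *\<^sub>R (xb0 - xa0)"
    obtain y where y: "trajectory f I c y"
      using complete I unfolding forward_complete_def by blast
    have "xa0 - c = a *\<^sub>R (xa0 - xb0)"
      by (simp add: c_def scaleR_diff_right)
    then have "norm (xa0 - c) = a * norm (xa0 - xb0)"
      using a(1) by simp
    also have "\<dots> \<le> 1"
      using mult_left_mono[OF Suc.prems(1) a(1)] a(3) by linarith
    finally have "\<beta> (norm (xa0 - c)) T \<le> 1/2"
      using class_KL_mono[OF KL norm_ge_zero, of "xa0 - c" 1 T T] T by simp
    then have 1: "norm (xa T - y T) \<le> 1/2"
      using state_diff_same_input[OF I Suc.prems(2) y T(1)] by linarith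
    have "c - xb0 = (1 - a) *\<^sub>R (xa0 - xb0)"
      by (simp add: c_def scaleR_diff_left scaleR_diff_right)
    then have "norm (c - xb0) = (1 - a) * norm (xa0 - xb0)"
      using a(2) by simp
    also have "\<dots> \<le> (1 - a) * real (Suc n)"
      using Suc.prems(1) a(2) by (intro mult_left_mono) auto
    also have "\<dots> = real n"
      using a(3) by (simp only: left_diff_distrib) simp
    finally have "norm (c - xb0) \<le> real n" .
    then have 2: "norm (y T - xb T) \<le> real n / 2"
      using Suc.IH y Suc.prems(3) by blast
    have "norm (xa T - xb T) \<le> norm (xa T - y T) + norm (y T - xb T)"
      using norm_triangle_ineq[of "xa T - y T" "y T - xb T"] by simp
    then show ?case using 1 2 by simp
  qed
  \<comment> \<open>The number of pieces exceeds the distance by at most 1; this is the additive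
    constant in the claim.\<close>
  define n where "n = nat \<lfloor>norm (xa0 - xb0)\<rfloor> + 1"
  have "norm (xa0 - xb0) \<le> real n" "real n \<le> norm (xa0 - xb0) + 1"
    using of_nat_floor[of "norm (xa0 - xb0)"] unfolding n_def by (linarith, simp)
  then show ?thesis using chain[OF _ x, of n] by simp
qed

text \<open>All trajectories are compared with one reference trajectory \<open>\<xi>\<close> from 0.
  A ball of radius \<open>\<rho>\<close> is invariant under the flow over time \<open>T\<close>, and
  between multiples of \<open>T\<close> the delta-ISS estimate limits the excursion. With no inputs
  there is no reference, but the claim is vacuous.\<close>

lemma states_bounded:
  assumes "compact X0"
  obtains B where "0 \<le> B"
    "\<And>I x0 x t. I \<in> \<U> \<Longrightarrow> x0 \<in> X0 \<Longrightarrow> trajectory f I x0 x \<Longrightarrow> 0 \<le> t \<Longrightarrow> norm (x t) \<le> B"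
proof (cases "\<U> = {}")
  case True
  then show ?thesis using that[of 0] by simp
next
  case False
  then obtain I0 where I0: "I0 \<in> \<U>" by blast
  then obtain \<xi> where \<xi>: "trajectory f I0 0 \<xi>"
    using complete unfolding forward_complete_def by blast
  have "eventually (\<lambda>T. \<beta> 1 T < 1/2) at_top"
    using KL by (intro order_tendstoD) (auto simp: class_KL_def)
  then obtain T where T: "0 < T" "\<beta> 1 T \<le> 1/2"
    using eventually_happens[OF eventually_conj[OF _ eventually_gt_at_top[of "0::real"]]]
    by (metis (no_types, lifting) less_imp_le trivial_limit_at_top_linorder)
  obtain C where C: "0 \<le> C" "\<And>s. 0 \<le> s \<Longrightarrow> s \<le> T \<Longrightarrow> norm (\<xi> s) \<le> C"
    using trajectory_bounded_on_interval[OF \<xi>, of T] by (metis diff_zero)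
  define G where "G = \<gamma> (2 * Ibar)"
  have G0: "0 \<le> G" using class_K_nonneg[OF K] Ibar_pos by (simp add: G_def)
  obtain b where b: "\<And>x. x \<in> X0 \<Longrightarrow> norm x \<le> b"
    using compact_imp_bounded[OF assms] by (auto simp: bounded_iff)
  \<comment> \<open>The ball contains \<open>X0\<close> because of \<open>b\<close>. The other entry
    is the solution of (rho + 1) / 2 + G + C = rho, which gives invariance.\<close>
  define \<rho> where "\<rho> = max b (1 + 2 * G + 2 * C)"
  have \<rho>0: "0 \<le> \<rho>" using G0 C(1) by (simp add: \<rho>_def)
  have step: "norm (x T) \<le> \<rho>" if "I \<in> \<U>" "trajectory f I x0 x" "norm x0 \<le> \<rho>" for I x0 x
  proof -
    obtain y where y: "trajectory f I 0 y"
      using complete \<open>I \<in> \<U>\<close> unfolding forward_complete_def by blast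
    \<comment> \<open>First the initial state is changed to 0 under the same input, then the input
      is changed to that of the reference.\<close>
    have "norm (x T - y T) \<le> (\<rho> + 1) / 2"
      using coarse_contraction[OF _ T(2) that(1,2) y] T(1) that(3) by simp
    moreover have "norm (y T - \<xi> T) \<le> G"
      using state_diff_bounded[OF that(1) I0 y \<xi>, of T] T(1) class_KL_zero[OF KL, of T]
      by (simp add: G_def)
    moreover have "norm (\<xi> T) \<le> C" using C(2)[of T] T(1) by simp
    moreover have "norm (x T) \<le> norm (x T - y T) + norm (y T - \<xi> T) + norm (\<xi> T)"
      using norm_triangle_ineq[of "x T - y T" "y T"] norm_triangle_ineq[of "y T - \<xi> T" "\<xi> T"] by simp
    moreover have "1 + 2 * G + 2 * C \<le> \<rho>" by (simp add: \<rho>_def)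
    ultimately show ?thesis by (simp add: field_simps)
  qed
  have steps: "norm (x (real n * T)) \<le> \<rho>"
    if *: "I \<in> \<U>" "x0 \<in> X0" "trajectory f I x0 x" for I x0 x n
  proof (induction n)
    case 0
    then show ?case using b[OF *(2)] trajectory_init[OF *(3)] by (simp add: \<rho>_def)
  next
    case (Suc n)
    obtain J where "J \<in> \<U>" "trajectory f J (x (real n * T)) (\<lambda>s. x (s + real n * T))"
      using shifted_input[OF *(1,3), of "real n * T"] T(1) by auto
    from step[OF this Suc] show ?case by (simp add: algebra_simps)
  qed
  show ?thesis
  proof
    show "0 \<le> \<beta> \<rho> 0 + G + C"
      using class_KL_nonneg[OF KL \<rho>0, of 0] G0 C(1) by simp
    fix I x0 x and t :: real
    assume *: "I \<in> \<U>" "x0 \<in> X0" "trajectory f I x0 x" and "0 \<le> t"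
    define n where "n = nat \<lfloor>t / T\<rfloor>"
    define s where "s = t - real n * T"
    have "real n \<le> t / T" "t / T \<le> real n + 1"
      using of_nat_floor[of "t / T"] \<open>0 \<le> t\<close> T(1) unfolding n_def by (simp, linarith)
    then have s: "0 \<le> s" "s \<le> T"
      using T(1) by (auto simp: s_def field_simps)
    obtain J where J: "J \<in> \<U>" "trajectory f J (x (real n * T)) (\<lambda>s. x (s + real n * T))"
      using shifted_input[OF *(1,3), of "real n * T"] T(1) by auto
    \<comment> \<open>The reference restarts from 0 at each multiple of \<open>T\<close>, so its
      bound on [0, T] is enough for all times.\<close>
    have "norm (x (s + real n * T) - \<xi> s) \<le> \<beta> (norm (x (real n * T))) s + G"
      using state_diff_bounded[OF J(1) I0 J(2) \<xi> s(1)] by (simp add: G_def)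
    moreover have "\<beta> (norm (x (real n * T))) s \<le> \<beta> \<rho> 0"
      using steps[OF *] s(1) by (intro class_KL_mono[OF KL]) auto
    ultimately show "norm (x t) \<le> \<beta> \<rho> 0 + G + C"
      using C(2)[OF s] norm_triangle_ineq[of "x t - \<xi> s" "\<xi> s"] by (simp add: s_def)
  qed
qed

section \<open>Fading memory of the state and of the output\<close>

lemma input_diff_le_faded_diff:
  assumes I: "Ia \<in> \<U>" "Ib \<in> \<U>" and "0 \<le> t"
    and cont: "continuous_on {0..} Ia" "continuous_on {0..} Ib"
  shows "\<bar>Ia t - Ib t\<bar> \<le> faded_diff Ia Ib t"
proof (cases "t = 0")
  case True
  then show ?thesis by (simp add: ess_sup_upto_def)
next
  case False
  have "continuous_on {0..t} Ia" "continuous_on {0..t} Ib"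
    using cont by (auto intro: continuous_on_subset)
  then have "continuous_on {0..t} (\<lambda>s. exp (- (t - s)) * \<bar>Ia s - Ib s\<bar>)"
    by (intro continuous_intros)
  \<comment> \<open>The weight equals 1 at s = t, so continuity turns the almost everywhere bound
    into a bound on the current input difference.\<close>
  from AE_Icc_le_imp_le_right_end[OF faded_diff_bounds(2)[OF I \<open>0 \<le> t\<close>] _ this]
  show ?thesis using False \<open>0 \<le> t\<close> by simp
qed

text \<open>Compactness enters through the finite diameter, which bounds the distance of initial
  states.\<close>

lemma state_fading_memory:
  assumes "compact X0"
  shows "fading_memory f \<U> (\<lambda>x i. x) X0"
proof -
  obtain \<kappa> where "class_K_inf \<kappa>"
    and \<kappa>: "\<And>xa0 xb0 Ia Ib xa xb t. Ia \<in> \<U> \<Longrightarrow> Ib \<in> \<U> \<Longrightarrow>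
      trajectory f Ia xa0 xa \<Longrightarrow> trajectory f Ib xb0 xb \<Longrightarrow>
      norm (xa0 - xb0) \<le> diameter X0 \<Longrightarrow> 0 \<le> t \<Longrightarrow>
      norm (xa t - xb t) \<le> \<beta> (norm (xa0 - xb0)) t + \<kappa> (faded_diff Ia Ib t)"
    using state_fading_gain[OF diameter_ge_0[OF compact_imp_bounded[OF assms]]] by blast
  moreover have "norm (xa0 - xb0) \<le> diameter X0" if "xa0 \<in> X0" "xb0 \<in> X0" for xa0 xb0
    using diameter_bounded_bound[OF compact_imp_bounded[OF assms] that] by (simp add: dist_norm)
  ultimately show ?thesis
    unfolding fading_memory_def using KL memory_kernel_exp
    by (intro exI[of _ \<beta>] exI[of _ \<kappa>] exI[of _ "\<lambda>s. exp (- s)"]) simp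
qed

text \<open>The output difference splits into a memristance times an input difference and a
  memristance difference times an input. The first is controlled by \<open>m\<close> on the ball
  that holds the states, the second by the Lipschitz constant and \<open>Ibar\<close>.\<close>

lemma output_fading_memory:
  assumes "compact X0" and cont: "\<And>I. I \<in> \<U> \<Longrightarrow> continuous_on {0..} I"
    and M: "L-lipschitz_on UNIV M"
  shows "fading_memory f \<U> (\<lambda>x i. M x * i) X0"
proof -
  obtain \<kappa> where \<kappa>K: "class_K_inf \<kappa>"
    and \<kappa>: "\<And>xa0 xb0 Ia Ib xa xb t. Ia \<in> \<U> \<Longrightarrow> Ib \<in> \<U> \<Longrightarrow>
      trajectory f Ia xa0 xa \<Longrightarrow> trajectory f Ib xb0 xb \<Longrightarrow>
      norm (xa0 - xb0) \<le> diameter X0 \<Longrightarrow> 0 \<le> t \<Longrightarrow>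
      norm (xa t - xb t) \<le> \<beta> (norm (xa0 - xb0)) t + \<kappa> (faded_diff Ia Ib t)"
    using state_fading_gain[OF diameter_ge_0[OF compact_imp_bounded[OF assms(1)]]] by blast
  obtain B where B: "0 \<le> B"
    "\<And>I x0 x t. I \<in> \<U> \<Longrightarrow> x0 \<in> X0 \<Longrightarrow> trajectory f I x0 x \<Longrightarrow> 0 \<le> t \<Longrightarrow> norm (x t) \<le> B"
    using states_bounded[OF assms(1)] by blast
  have L0: "0 \<le> L" using M by (rule lipschitz_on_nonneg)
  have M_diff: "\<bar>M x - M y\<bar> \<le> L * norm (x - y)" for x y
    using lipschitz_onD[OF M, of x y] by (simp add: dist_norm)
  define m where "m = \<bar>M 0\<bar> + L * B"
  have m0: "0 \<le> m" using L0 B(1) by (simp add: m_def)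
  \<comment> \<open>The summand 1 keeps the factor positive when L = 0, as scaling a comparison
    function requires.\<close>
  define c where "c = L * Ibar + 1"
  have c: "0 < c" "L * Ibar \<le> c" using L0 Ibar_pos by (auto simp: c_def add_nonneg_pos)
  show ?thesis
    unfolding fading_memory_def
  proof (intro exI conjI ballI allI impI)
    show "class_KL (\<lambda>r s. c * \<beta> r s)" using KL c(1) by (rule class_KL_scale)
    show "class_K_inf (\<lambda>v. c * \<kappa> v + m * v)" using \<kappa>K c(1) m0 by (rule class_K_inf_scale_add)
    show "memory_kernel (\<lambda>s. exp (- s))" by (rule memory_kernel_exp)
    fix xa0 xb0 Ia Ib xa xb and t :: real
    assume X0: "xa0 \<in> X0" "xb0 \<in> X0" and I: "Ia \<in> \<U>" "Ib \<in> \<U>"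
      and x: "trajectory f Ia xa0 xa" "trajectory f Ib xb0 xb" and t: "0 \<le> t"
    define v where "v = faded_diff Ia Ib t"
    define e where "e = norm (xa t - xb t)"
    have "norm (xa0 - xb0) \<le> diameter X0"
      using diameter_bounded_bound[OF compact_imp_bounded[OF assms(1)] X0] by (simp add: dist_norm)
    then have e: "e \<le> \<beta> (norm (xa0 - xb0)) t + \<kappa> v"
      using \<kappa>[OF I x _ t] by (simp add: e_def v_def)
    have "L * norm (xa t) \<le> L * B" using B(2)[OF I(1) X0(1) x(1) t] L0 by (rule mult_left_mono)
    then have Ma: "\<bar>M (xa t)\<bar> \<le> m"
      using M_diff[of "xa t" 0] by (simp add: m_def)
    have "M (xa t) * Ia t - M (xb t) * Ib t
        = M (xa t) * (Ia t - Ib t) + (M (xa t) - M (xb t)) * Ib t"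
      by (simp add: algebra_simps)
    then have "norm (M (xa t) * Ia t - M (xb t) * Ib t)
        \<le> \<bar>M (xa t)\<bar> * \<bar>Ia t - Ib t\<bar> + \<bar>M (xa t) - M (xb t)\<bar> * \<bar>Ib t\<bar>"
      by (metis abs_mult abs_triangle_ineq real_norm_def)
    also have "\<dots> \<le> m * v + (L * e) * Ibar"
    proof (intro add_mono mult_mono)
      show "\<bar>Ia t - Ib t\<bar> \<le> v"
        unfolding v_def using I cont t by (intro input_diff_le_faded_diff)
    qed (use Ma m0 M_diff Ibar[OF I(2) t] L0 in \<open>auto simp: e_def\<close>)
    also have "\<dots> \<le> m * v + c * e"
      using mult_right_mono[OF c(2), of e] by (simp add: e_def mult_ac)
    also have "\<dots> \<le> m * v + c * (\<beta> (norm (xa0 - xb0)) t + \<kappa> v)"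
      using e c(1) by simp
    finally show "norm (M (xa t) * Ia t - M (xb t) * Ib t)
        \<le> c * \<beta> (norm (xa0 - xb0)) t + (c * \<kappa> (faded_diff Ia Ib t) + m * faded_diff Ia Ib t)"
      by (simp add: v_def algebra_simps)
  qed
qed

end

theorem proposition10:
  fixes f :: "real^'n \<Rightarrow> real \<Rightarrow> real^'n"
    and M :: "real^'n \<Rightarrow> real"
    and \<U> :: "(real \<Rightarrow> real) set"
  assumes "\<U> \<subseteq> L_infinity"
    and "shift_closed \<U>"
    and "equibounded \<U>"
    and "\<forall>x. M x > 0"
    and "forward_complete f \<U>"
    and "globally_dISS f \<U>"
  shows "fading_memory_on_compacts f \<U> (\<lambda>x i. x) \<and>
    ((\<forall>I\<in>\<U>. continuous_on {0..} I) \<and> (\<exists>L. L-lipschitz_on UNIV M) \<longrightarrow>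
       fading_memory_on_compacts f \<U> (\<lambda>x i. M x * i))"
proof -
  obtain Ibar where Ibar: "0 < Ibar" "\<forall>I\<in>\<U>. \<forall>t\<ge>0. \<bar>I t\<bar> \<le> Ibar"
    using \<open>equibounded \<U>\<close> unfolding equibounded_def by blast
  obtain \<beta> \<gamma> where \<beta>\<gamma>: "class_KL \<beta>" "class_K_inf \<gamma>"
    "\<forall>xa0 xb0. \<forall>Ia\<in>\<U>. \<forall>Ib\<in>\<U>. \<forall>xa xb.
       trajectory f Ia xa0 xa \<longrightarrow> trajectory f Ib xb0 xb \<longrightarrow>
       (\<forall>t\<ge>0. norm (xa t - xb t) \<le>
          \<beta> (norm (xa0 - xb0)) t + \<gamma> (ess_sup_upto t (\<lambda>s. \<bar>Ia s - Ib s\<bar>)))"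
    using \<open>globally_dISS f \<U>\<close> unfolding globally_dISS_def by blast
  interpret dISS_system f \<U> \<beta> \<gamma> Ibar
    using assms(1,2,5) Ibar \<beta>\<gamma> by unfold_locales auto
  show ?thesis
    unfolding fading_memory_on_compacts_def
    using state_fading_memory output_fading_memory by blast
qed

end
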